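(* Let $n\ge1$, let $f,g:\mathbb{R}^n\to\mathbb{R}_{\geq0}$ be log-concave functions and let $\lambda\in(0,1)$. If there exists a hyperplane $H\in\mathcal{L}^n_{n-1}$ such that $$\mathrm{proj}_H(f)=\mathrm{proj}_H(g),$$ then $$\int_{\mathbb{R}^n}(1-\lambda) f\star\lambda g\,\mathrm{d} x \;\geq\; (1-\lambda)\int_{\mathbb{R}^n}f\,\mathrm{d} x +\lambda\int_{\mathbb{R}^n}g\,\mathrm{d} x.$$
   Context: Integrals of non-negative functions are Lebesgue integrals with values in $[0,\infty]$. $\mathcal{L}^n_{n-1}$ is the set of $(n-1)$-dimensional linear subspaces of $\mathbb{R}^n$. A function $f:\mathbb{R}^n\to\mathbb{R}_{\ge0}$ is log-concave if $f=e^{-u}$ with $u:\mathbb{R}^n\to\mathbb{R}\cup\{\infty\}$ convex (with $e^{-\infty}=0$). For $f,g:\mathbb{R}^n\to\mathbb{R}_{\ge0}$ and $\lambda\in(0,1)$, the Asplund sum $(1-\lambda) f\star\lambda g:\mathbb{R}^n\to\mathbb{R}_{\geq0}\cup\{\infty\}$ is $$\bigl((1-\lambda) f\star\lambda g\bigr)(x)=\sup_{(1-\lambda) x_1+\lambda x_2=x} f(x_1)^{1-\lambda} g(x_2)^{\lambda}.$$ For $f:\mathbb{R}^n\to\mathbb{R}_{\ge0}\cup\{\infty\}$ and $H\in\mathcal{L}^n_{n-1}$ with unit normal vector $\nu$, $\mathrm{proj}_H(f):H\to\mathbb{R}_{\ge0}\cup\{\infty\}$ is defined by $\mathrm{proj}_H(f)(h)=\sup_{\alpha\in\mathbb{R}}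 f(h+\alpha\nu)$. *)

theory Defs
  imports "HOL-Analysis.Analysis"
begin

text \<open>Convex functions with values in the reals together with \<open>\<infinity>\<close>: the value \<open>-\<infinity>\<close> is
  excluded, while \<open>u = \<infinity>\<close> everywhere is allowed.\<close>

definition ext_convex :: "('a::real_vector \<Rightarrow> ereal) \<Rightarrow> bool" where
  "ext_convex u \<longleftrightarrow> (\<forall>x. u x \<noteq> -\<infinity>) \<and>
     (\<forall>x y. \<forall>t\<in>{0<..<1}.
        u ((1 - t) *\<^sub>R x + t *\<^sub>R y) \<le> ereal (1 - t) * u x + ereal t * u y)"

definition exp_neg :: "ereal \<Rightarrow> real" where
  "exp_neg e = (if e = \<infinity> then 0 else exp (- real_of_ereal e))"

definition log_concave :: "('a::real_vector \<Rightarrow> real) \<Rightarrow> bool" where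
  "log_concave f \<longleftrightarrow> (\<exists>u. ext_convex u \<and> (\<forall>x. f x = exp_neg (u x)))"

text \<open>The exponents are positive whenever \<open>0 < lam < 1\<close>, so \<open>0 powr a = 0\<close> is the
  expected value; the map \<open>ennreal\<close> loses nothing as the arguments are non-negative.\<close>

definition asplund_sum ::
  "real \<Rightarrow> ('a::real_vector \<Rightarrow> real) \<Rightarrow> ('a \<Rightarrow> real) \<Rightarrow> 'a \<Rightarrow> ennreal" where
  "asplund_sum lam f g x =
     (SUP (x1, x2) \<in> {(x1, x2). (1 - lam) *\<^sub>R x1 + lam *\<^sub>R x2 = x}.
        ennreal (f x1 powr (1 - lam) * g x2 powr lam))"

definition linear_hyperplanes :: "'a::euclidean_space set set" where
  "linear_hyperplanes = {H. subspace H \<and> dim H = DIM('a) - 1}"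

definition unit_normal :: "'a::euclidean_space set \<Rightarrow> 'a \<Rightarrow> bool" where
  "unit_normal H \<nu> \<longleftrightarrow> norm \<nu> = 1 \<and> (\<forall>h\<in>H. \<nu> \<bullet> h = 0)"

text \<open>The projection is a function on \<open>H\<close>, hence the restriction. The choice of the
  unit normal is immaterial, see \<open>proj_fun_eq\<close> below.\<close>

definition proj_fun :: "'a::euclidean_space set \<Rightarrow> ('a \<Rightarrow> ennreal) \<Rightarrow> 'a \<Rightarrow> ennreal" where
  "proj_fun H f = (\<lambda>h\<in>H. SUP \<alpha>::real. f (h + \<alpha> *\<^sub>R (SOME \<nu>. unit_normal H \<nu>)))"

lemma unit_normal_exists:
  fixes H :: "'a::euclidean_space set"
  assumes "H \<in> linear_hyperplanes"
  shows "\<exists>\<nu>. unit_normal H \<nu>"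
proof -
  have "dim H < DIM('a)"
    using assms DIM_positive[where 'a='a] by (simp add: linear_hyperplanes_def)
  then obtain a where a: "a \<noteq> 0" "span H \<subseteq> {x. a \<bullet> x = 0}"
    using lowdim_subset_hyperplane by blast
  have "unit_normal H (a /\<^sub>R norm a)"
    using a span_superset[of H] by (auto simp: unit_normal_def)
  then show ?thesis ..
qed

lemma unit_normal_unique:
  fixes H :: "'a::euclidean_space set"
  assumes H: "H \<in> linear_hyperplanes" and n: "unit_normal H \<nu>" and m: "unit_normal H \<mu>"
  shows "\<mu> = \<nu> \<or> \<mu> = - \<nu>"
proof -
  have nz: "\<nu> \<noteq> 0" using n by (auto simp: unit_normal_def)
  have "H = {x. \<nu> \<bullet> x = 0}"
  proof (rule subspace_dim_equal)
    show "subspace H" using H by (simp add: linear_hyperplanes_def)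
    show "dim {x. \<nu> \<bullet> x = 0} \<le> dim H"
      using H nz by (simp add: linear_hyperplanes_def dim_hyperplane)
  qed (use n in \<open>auto simp: unit_normal_def subspace_hyperplane\<close>)
  moreover define c where "c = \<mu> \<bullet> \<nu>"
  have nn: "\<nu> \<bullet> \<nu> = 1" using n by (simp add: unit_normal_def dot_square_norm)
  ultimately have w: "\<mu> - c *\<^sub>R \<nu> \<in> H"
    by (simp add: inner_diff_right inner_commute c_def)
  have "(\<mu> - c *\<^sub>R \<nu>) \<bullet> (\<mu> - c *\<^sub>R \<nu>) = \<mu> \<bullet> (\<mu> - c *\<^sub>R \<nu>) - c * (\<nu> \<bullet> (\<mu> - c *\<^sub>R \<nu>))"
    by (simp add: inner_diff_left)
  also have "\<dots> = 0" using w n m by (simp add: unit_normal_def)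
  finally have e: "\<mu> = c *\<^sub>R \<nu>" by simp
  then have "\<bar>c\<bar> = 1" using n m by (simp add: unit_normal_def)
  then show ?thesis using e by (auto simp: abs_if split: if_splits)
qed

lemma proj_fun_eq:
  fixes H :: "'a::euclidean_space set"
  assumes H: "H \<in> linear_hyperplanes" and n: "unit_normal H \<nu>" and h: "h \<in> H"
  shows "proj_fun H f h = (SUP \<alpha>::real. f (h + \<alpha> *\<^sub>R \<nu>))"
proof -
  define \<mu> where "\<mu> = (SOME \<nu>. unit_normal H \<nu>)"
  have "unit_normal H \<mu>"
    unfolding \<mu>_def using unit_normal_exists[OF H] by (rule someI_ex)
  then consider "\<mu> = \<nu>" | "\<mu> = - \<nu>"
    using unit_normal_unique[OF H n] by blast
  then have "range (\<lambda>\<alpha>::real. f (h + \<alpha> *\<^sub>R \<mu>)) = range (\<lambda>\<alpha>::real. f (h + \<alpha> *\<^sub>R \<nu>))"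
  proof cases
    case 2
    have "range (\<lambda>\<alpha>::real. f (h + \<alpha> *\<^sub>R \<nu>)) = (\<lambda>\<alpha>. f (h + \<alpha> *\<^sub>R \<nu>)) ` range uminus"
      by (simp only: surj_uminus)
    also have "\<dots> = range (\<lambda>\<alpha>::real. f (h + (- \<alpha>) *\<^sub>R \<nu>))"
      by (simp only: image_image)
    finally show ?thesis using 2 by simp
  qed simp
  then show ?thesis using h by (simp add: proj_fun_def \<mu>_def)
qed

end

theory Submission
  imports Defs
begin

text \<open>On each line orthogonal to \<open>H\<close>, the restrictions of \<open>f\<close> and \<open>g\<close> have the same supremum,
  so their superlevel sets are nonempty at the same levels. The Asplund sum exceeds \<open>t\<close> at
  \<open>(1 - lam) a + lam b\<close> whenever \<open>f a > t\<close> and \<open>g b > t\<close>, hence one-dimensional Brunn--Minkowski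
  and the layer-cake formula give the inequality on every such line, and it remains to integrate
  over the lines. Log-concavity only serves measurability and the convexity of superlevel sets.\<close>

section \<open>Superlevel sets\<close>

text \<open>The weighted geometric mean is at least \<open>min p q\<close>, which still exceeds
  \<open>t\<close>. This keeps strict superlevel sets stable under the products in log-concavity and
  in the Asplund sum.\<close>

lemma less_geometric_mean:
  fixes t p q s :: real
  assumes "0 \<le> t" "t < p" "t < q" "0 < s" "s < 1"
  shows "t < p powr (1 - s) * q powr s"
proof -
  define m where "m = min p q"
  have m: "t < m" "0 < m" "m \<le> p" "m \<le> q" using assms by (auto simp: m_def)
  have "m = m powr (1 - s) * m powr s"
    using m by (simp flip: powr_add)
  also have "\<dots> \<le> p powr (1 - s) * q powr s"
    using m assms by (intro mult_mono powr_mono2) auto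
  finally show ?thesis using m by simp
qed

lemma log_concave_nonneg: "log_concave f \<Longrightarrow> 0 \<le> f x"
  by (auto simp: log_concave_def exp_neg_def)

text \<open>The exponential turns the convexity inequality for \<open>u\<close> into an inequality
  between products.\<close>

lemma log_concaveD:
  assumes f: "log_concave f" and s: "0 < s" "s < 1"
  shows "f x powr (1 - s) * f y powr s \<le> f ((1 - s) *\<^sub>R x + s *\<^sub>R y)"
proof -
  obtain u where u: "ext_convex u" and fu: "\<And>x. f x = exp_neg (u x)"
    using f by (auto simp: log_concave_def)
  let ?z = "(1 - s) *\<^sub>R x + s *\<^sub>R y"
  have le: "u ?z \<le> ereal (1 - s) * u x + ereal s * u y" and ninf: "\<And>x. u x \<noteq> -\<infinity>"
    using u s by (auto simp: ext_convex_def)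
  show ?thesis
  proof (cases "u x = \<infinity> \<or> u y = \<infinity>")
    case True
    \<comment> \<open>Infinite \<open>u\<close> means value 0 of \<open>f\<close>, and
      \<open>0 powr a = 0\<close> kills the product.\<close>
    then have "f x powr (1 - s) * f y powr s = 0" by (auto simp: fu exp_neg_def)
    then show ?thesis by (simp only: log_concave_nonneg[OF f])
  next
    case False
    then obtain a b where ab: "u x = ereal a" "u y = ereal b"
      using ninf by (metis ereal_cases)
    with le have "u ?z \<le> ereal ((1 - s) * a + s * b)" by simp
    then obtain c where c: "u ?z = ereal c" "c \<le> (1 - s) * a + s * b"
      using ninf[of ?z] by (cases "u ?z") auto
    have "f x powr (1 - s) * f y powr s = exp (- ((1 - s) * a + s * b))"
      by (simp add: fu ab exp_neg_def powr_def flip: exp_add)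
    also have "\<dots> \<le> f ?z" using c by (simp add: fu exp_neg_def)
    finally show ?thesis .
  qed
qed

lemma convex_superlevel_log_concave:
  assumes f: "log_concave f"
  shows "convex {x. t < ennreal (f x)}"
  unfolding convex_alt
proof (intro ballI allI impI)
  fix x y s assume xy: "x \<in> {x. t < ennreal (f x)}" "y \<in> {x. t < ennreal (f x)}"
    and s: "(0::real) \<le> s \<and> s \<le> 1"
  show "(1 - s) *\<^sub>R x + s *\<^sub>R y \<in> {x. t < ennreal (f x)}"
  proof (cases "s = 0 \<or> s = 1")
    case False
    with s have s: "0 < s" "s < 1" by auto
    from xy obtain r where r: "t = ennreal r" "0 \<le> r" by (cases t) auto
    with xy have "r < f x" "r < f y" by (auto simp: ennreal_less_iff)
    from less_geometric_mean[OF r(2) this s] log_concaveD[OF f s, of x y]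
    show ?thesis using r by (simp add: ennreal_less_iff)
  qed (use xy in auto)
qed

lemma less_asplund_sum_iff:
  "t < asplund_sum lam f g x \<longleftrightarrow>
    (\<exists>x1 x2. (1 - lam) *\<^sub>R x1 + lam *\<^sub>R x2 = x \<and> t < ennreal (f x1 powr (1 - lam) * g x2 powr lam))"
  by (auto simp: asplund_sum_def less_SUP_iff)

text \<open>Decompositions of \<open>x\<close> and \<open>y\<close> that witness a value above
  \<open>t\<close> are interpolated componentwise. Convexity of these sets is what makes the Asplund
  sum, a supremum over an uncountable family, measurable.\<close>

lemma convex_superlevel_asplund_sum:
  assumes f: "log_concave f" and g: "log_concave g" and lam: "0 < lam" "lam < 1"
  shows "convex {x. t < asplund_sum lam f g x}"
  unfolding convex_alt
proof (intro ballI allI impI)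
  fix x y s assume xy: "x \<in> {x. t < asplund_sum lam f g x}" "y \<in> {x. t < asplund_sum lam f g x}"
    and s: "(0::real) \<le> s \<and> s \<le> 1"
  show "(1 - s) *\<^sub>R x + s *\<^sub>R y \<in> {x. t < asplund_sum lam f g x}"
  proof (cases "s = 0 \<or> s = 1")
    case False
    with s have s: "0 < s" "s < 1" by auto
    from xy obtain x1 x2 y1 y2 where x: "(1 - lam) *\<^sub>R x1 + lam *\<^sub>R x2 = x"
      "t < ennreal (f x1 powr (1 - lam) * g x2 powr lam)"
      and y: "(1 - lam) *\<^sub>R y1 + lam *\<^sub>R y2 = y"
      "t < ennreal (f y1 powr (1 - lam) * g y2 powr lam)"
      by (auto simp: less_asplund_sum_iff)
    from x obtain r where r: "t = ennreal r" "0 \<le> r" by (cases t) auto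
    let ?P = "f x1 powr (1 - lam) * g x2 powr lam" and ?Q = "f y1 powr (1 - lam) * g y2 powr lam"
    let ?z1 = "(1 - s) *\<^sub>R x1 + s *\<^sub>R y1" and ?z2 = "(1 - s) *\<^sub>R x2 + s *\<^sub>R y2"
    have "r < ?P" "r < ?Q" using x y r by (auto simp: ennreal_less_iff)
    from less_geometric_mean[OF r(2) this s]
    have "r < ?P powr (1 - s) * ?Q powr s" .
    \<comment> \<open>The two kinds of weighted geometric mean commute, which separates the factors
      of \<open>f\<close> from those of \<open>g\<close>.\<close>
    also have "\<dots> = (f x1 powr (1 - s) * f y1 powr s) powr (1 - lam)
        * (g x2 powr (1 - s) * g y2 powr s) powr lam"
      using log_concave_nonneg[OF f] log_concave_nonneg[OF g]
      by (simp add: powr_mult powr_powr mult.commute mult.left_commute)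
    also have "\<dots> \<le> f ?z1 powr (1 - lam) * g ?z2 powr lam"
      using log_concaveD[OF f s] log_concaveD[OF g s] lam
      by (intro mult_mono powr_mono2) auto
    finally have "t < ennreal (f ?z1 powr (1 - lam) * g ?z2 powr lam)"
      using r by (simp add: ennreal_less_iff)
    moreover have "(1 - lam) *\<^sub>R ?z1 + lam *\<^sub>R ?z2 = (1 - s) *\<^sub>R x + s *\<^sub>R y"
      unfolding x(1)[symmetric] y(1)[symmetric] by (simp add: algebra_simps)
    ultimately show ?thesis unfolding mem_Collect_eq less_asplund_sum_iff by blast
  qed (use xy in auto)
qed

section \<open>Measurability from convex superlevel sets\<close>

text \<open>A convex set is its open interior together with part of its frontier. The frontier is
  negligible, and subsets of negligible sets are Lebesgue measurable, though not always
  Borel.\<close>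

lemma lebesgue_sets_convex:
  fixes S :: "'a::euclidean_space set"
  assumes "convex S"
  shows "S \<in> sets lebesgue"
proof -
  have "S = interior S \<union> (S \<inter> frontier S)"
    using interior_subset[of S] closure_subset[of S] by (auto simp: frontier_def)
  moreover have "S \<inter> frontier S \<in> sets lebesgue"
    using negligible_convex_frontier[OF assms]
    by (meson inf_le2 negligible_imp_sets negligible_subset)
  moreover have "interior S \<in> sets lebesgue" by simp
  ultimately show ?thesis by (metis sets.Un)
qed

lemma borel_sets_convex_real:
  fixes S :: "real set"
  assumes "convex S"
  shows "S \<in> sets borel"
  using is_real_interval[OF assms[folded is_interval_convex_1]] by auto

lemma borel_measurable_lebesgue_quasiconcave:
  fixes F :: "'a::euclidean_space \<Rightarrow> ennreal"
  assumes "\<And>t. convex {x. t < F x}"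
  shows "F \<in> borel_measurable lebesgue"
  by (intro borel_measurableI_greater) (simp add: lebesgue_sets_convex assms)

lemma borel_measurable_quasiconcave_real:
  fixes F :: "real \<Rightarrow> ennreal"
  assumes "\<And>t. convex {x. t < F x}"
  shows "F \<in> borel_measurable borel"
  by (intro borel_measurableI_greater) (simp add: borel_sets_convex_real assms)

text \<open>The map from \<open>a\<close> to \<open>x + a *\<^sub>R v\<close> is affine, and affine
  preimages of convex sets are convex. Hence restrictions to every single line are Borel, even where
  the function on the whole space is only Lebesgue measurable.\<close>

lemma convex_superlevel_line:
  assumes "convex {x. t < F x}"
  shows "convex {a::real. t < F (x + a *\<^sub>R v)}"
  unfolding convex_alt
proof (intro ballI allI impI, unfold mem_Collect_eq)
  fix a b s :: real
  assume "t < F (x + a *\<^sub>R v)" "t < F (x + b *\<^sub>R v)" "0 \<le> s \<and> s \<le> 1"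
  with assms have "t < F ((1 - s) *\<^sub>R (x + a *\<^sub>R v) + s *\<^sub>R (x + b *\<^sub>R v))"
    unfolding convex_alt by blast
  then show "t < F (x + ((1 - s) *\<^sub>R a + s *\<^sub>R b) *\<^sub>R v)"
    by (simp add: algebra_simps)
qed

section \<open>The inequality on a line\<close>

lemma emeasure_le_width:
  fixes A :: "real set"
  assumes ne: "A \<noteq> {}" and w: "\<And>a a'. a \<in> A \<Longrightarrow> a' \<in> A \<Longrightarrow> a' - a \<le> k"
  shows "emeasure lborel A \<le> ennreal k"
proof -
  obtain a0 where a0: "a0 \<in> A" using ne by auto
  have bd: "bdd_above A" "bdd_below A"
    using w[OF a0] w[OF _ a0] by (auto intro!: bdd_aboveI[of _ "a0 + k"] bdd_belowI[of _ "a0 - k"]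
        simp: algebra_simps)
  have "Sup A \<le> Inf A + k"
  proof (rule cSup_least[OF ne])
    fix a' assume a': "a' \<in> A"
    have "a' - k \<le> Inf A" by (rule cInf_greatest[OF ne]) (use w[OF _ a'] in \<open>simp add: algebra_simps\<close>)
    then show "a' \<le> Inf A + k" by simp
  qed
  moreover have "Inf A \<le> Sup A" using bd ne by (intro cInf_le_cSup)
  moreover have "A \<subseteq> {Inf A..Sup A}" using bd by (auto intro: cInf_lower cSup_upper)
  then have "emeasure lborel A \<le> emeasure lborel {Inf A..Sup A}" by (intro emeasure_mono) auto
  ultimately show ?thesis by (auto intro: order_trans ennreal_leI)
qed

text \<open>The convex set \<open>C\<close> is an interval, so distances in it are bounded by its
  measure \<open>c\<close>. Applied to two combined points this bounds a weighted sum of distances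
  in \<open>A\<close> and in \<open>B\<close> by \<open>c\<close>; passing to the widths of
  \<open>A\<close> and then of \<open>B\<close> gives the claim. Infinite measure of
  \<open>C\<close> is trivial.\<close>

lemma brunn_minkowski_real:
  fixes A B C :: "real set"
  assumes ne: "A \<noteq> {}" "B \<noteq> {}" and C: "convex C" and lam: "0 < lam" "lam < 1"
    and sub: "\<And>a b. a \<in> A \<Longrightarrow> b \<in> B \<Longrightarrow> (1 - lam) * a + lam * b \<in> C"
  shows "ennreal (1 - lam) * emeasure lborel A + ennreal lam * emeasure lborel B
    \<le> emeasure lborel C"
proof (cases "emeasure lborel C")
  case (real c)
  have Cw: "y - x \<le> c" if "x \<in> C" "y \<in> C" for x y
  proof (cases "x \<le> y")
    case True
    have "{x..y} \<subseteq> C" using C that by (metis connected_contains_Icc convex_connected)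
    then have "emeasure lborel {x..y} \<le> emeasure lborel C"
      by (intro emeasure_mono) (simp_all add: borel_sets_convex_real C)
    then show ?thesis using True real by simp
  qed (use real in auto)
  have w: "(1 - lam) * (a' - a) + lam * (b' - b) \<le> c"
    if "a \<in> A" "a' \<in> A" "b \<in> B" "b' \<in> B" for a a' b b'
    using Cw[OF sub[OF that(1,3)] sub[OF that(2,4)]] by (simp add: algebra_simps)
  \<comment> \<open>With \<open>b\<close> and \<open>b'\<close> fixed, \<open>w\<close> bounds the
    width of \<open>A\<close>. In particular the measure of \<open>A\<close> is finite, so it can be
    subtracted below.\<close>
  have Aw: "emeasure lborel A \<le> ennreal ((c - lam * (b' - b)) / (1 - lam))"
    if "b \<in> B" "b' \<in> B" for b b'
    by (rule emeasure_le_width[OF ne(1)]) (use w that lam in \<open>simp add: field_simps\<close>)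
  obtain b0 where b0: "b0 \<in> B" using ne by auto
  obtain a0 where a0: "a0 \<in> A" using ne by auto
  obtain \<alpha> where \<alpha>: "emeasure lborel A = ennreal \<alpha>" "0 \<le> \<alpha>"
    using Aw[OF b0 b0] by (cases "emeasure lborel A") (auto simp: top_unique)
  have "b' - b \<le> (c - (1 - lam) * \<alpha>) / lam" if "b \<in> B" "b' \<in> B" for b b'
  proof -
    \<comment> \<open>This is \<open>w\<close> with both points of \<open>A\<close> equal to
      \<open>a0\<close>. Without it \<open>ennreal\<close> might truncate a negative bound to 0, and
      the comparison could not be moved to the reals.\<close>
    have "0 \<le> (c - lam * (b' - b)) / (1 - lam)"
      using w[OF a0 a0 that] lam by simp
    with Aw[OF that] \<alpha> have "\<alpha> \<le> (c - lam * (b' - b)) / (1 - lam)" by simp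
    then show ?thesis using lam by (simp add: field_simps)
  qed
  note Bw = emeasure_le_width[OF ne(2) this]
  have nn: "0 \<le> (c - (1 - lam) * \<alpha>) / lam"
    using Aw[OF b0 b0] \<alpha> real lam by (simp add: field_simps)
  have "ennreal (1 - lam) * emeasure lborel A + ennreal lam * emeasure lborel B
      \<le> ennreal (1 - lam) * ennreal \<alpha> + ennreal lam * ennreal ((c - (1 - lam) * \<alpha>) / lam)"
    using Bw \<alpha> by (intro add_mono mult_left_mono) auto
  also have "\<dots> = ennreal c"
  proof -
    have "0 \<le> (1 - lam) * \<alpha>" "0 \<le> c - (1 - lam) * \<alpha>"
      using lam \<alpha> nn by (auto simp: zero_le_divide_iff)
    moreover have "ennreal lam * ennreal ((c - (1 - lam) * \<alpha>) / lam) = ennreal (c - (1 - lam) * \<alpha>)"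
      using lam nn by (simp flip: ennreal_mult)
    ultimately show ?thesis
      using lam \<alpha> by (simp add: ennreal_plus[symmetric] ennreal_mult[symmetric] del: ennreal_plus)
  qed
  finally show ?thesis using real by simp
qed simp

section \<open>Layer-cake formula and integration over levels\<close>

lemma emeasure_less_ennreal:
  "emeasure lborel {t. 0 \<le> t \<and> ennreal t < c} = c"
proof (cases c)
  case (real r)
  then have "{t. 0 \<le> t \<and> ennreal t < c} = {0..<r}" by (auto simp: ennreal_less_iff)
  then show ?thesis using real by simp
next
  case top
  then have eq: "{t. 0 \<le> t \<and> ennreal t < c} = {0..}" by auto
  have "emeasure lborel {0::real..} = top"
  proof (cases "emeasure lborel {0::real..}")
    case (real r)
    \<comment> \<open>A finite measure \<open>r\<close> of the half-line would be exceeded by this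
      interval.\<close>
    have "emeasure lborel {0..r + 1} \<le> emeasure lborel {0::real..}" by (intro emeasure_mono) auto
    then show ?thesis using real by simp
  qed
  then show ?thesis using top eq by simp
qed

text \<open>Tonelli for the region under the graph: slices over \<open>x\<close> have length
  \<open>F x\<close>, slices at height \<open>t\<close> are superlevel sets. The factor
  \<open>indicator {0..} t\<close> discards negative \<open>t\<close>, which \<open>ennreal\<close>
  would send to 0.\<close>

lemma layer_cake:
  fixes F :: "'a::euclidean_space \<Rightarrow> ennreal"
  assumes [measurable]: "F \<in> borel_measurable borel"
  shows "(\<integral>\<^sup>+ x. F x \<partial>lborel)
    = (\<integral>\<^sup>+ t. indicator {0..} t * emeasure lborel {x. ennreal t < F x} \<partial>lborel)" (is "?l = ?r")
    and "(\<lambda>t. indicator {0..} t * emeasure lborel {x. ennreal t < F x}) \<in> borel_measurable lborel"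
      (is ?m)
proof -
  let ?I = "\<lambda>x t. indicator {t. 0 \<le> t \<and> ennreal t < F x} t :: ennreal"
  have m: "(\<lambda>(x, t). ?I x t) \<in> borel_measurable (lborel \<Otimes>\<^sub>M lborel)"
    unfolding indicator_def by measurable
  have eq: "(\<integral>\<^sup>+ x. ?I x t \<partial>lborel) = indicator {0..} t * emeasure lborel {x. ennreal t < F x}" for t
  proof -
    have "{x. ennreal t < F x} \<in> sets lborel" by measurable
    then have "indicator {0..} t * emeasure lborel {x. ennreal t < F x}
      = (\<integral>\<^sup>+ x. indicator {0..} t * indicator {x. ennreal t < F x} x \<partial>lborel)"
      by (simp add: nn_integral_cmult)
    also have "\<dots> = (\<integral>\<^sup>+ x. ?I x t \<partial>lborel)"
      by (intro nn_integral_cong) (auto simp: indicator_def)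
    finally show ?thesis by simp
  qed
  have "?l = (\<integral>\<^sup>+ x. (\<integral>\<^sup>+ t. ?I x t \<partial>lborel) \<partial>lborel)"
    by (subst nn_integral_indicator) (simp_all add: emeasure_less_ennreal)
  also have "\<dots> = (\<integral>\<^sup>+ t. (\<integral>\<^sup>+ x. ?I x t \<partial>lborel) \<partial>lborel)"
    by (rule lborel_pair.Fubini'[OF m, symmetric])
  finally show "?l = ?r" by (simp add: eq)
  have "(\<lambda>t. \<integral>\<^sup>+ x. ?I x t \<partial>lborel) \<in> borel_measurable lborel"
    using m by measurable
  then show ?m by (simp add: eq)
qed

text \<open>The common supremum excludes levels at which exactly one of the two superlevel sets is
  empty. At every level either both are nonempty and Brunn-Minkowski applies, or both are empty and
  the left side vanishes.\<close>

lemma nn_integral_line_ge: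
  fixes F f g :: "real \<Rightarrow> ennreal"
  assumes [measurable]: "f \<in> borel_measurable borel" "g \<in> borel_measurable borel"
    and F: "\<And>t. convex {x. t < F x}" and lam: "0 < lam" "lam < 1"
    and sup: "(SUP a. f a) = (SUP a. g a)"
    and le: "\<And>a b t. t < f a \<Longrightarrow> t < g b \<Longrightarrow> t < F ((1 - lam) * a + lam * b)"
  shows "ennreal (1 - lam) * (\<integral>\<^sup>+ a. f a \<partial>lborel) + ennreal lam * (\<integral>\<^sup>+ a. g a \<partial>lborel)
    \<le> (\<integral>\<^sup>+ a. F a \<partial>lborel)"
proof -
  have mF: "F \<in> borel_measurable borel" by (rule borel_measurable_quasiconcave_real[OF F])
  have le': "ennreal (1 - lam) * emeasure lborel {x. t < f x}
      + ennreal lam * emeasure lborel {x. t < g x} \<le> emeasure lborel {x. t < F x}" for t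
  proof (cases "t < (SUP a. f a)")
    case True
    then have "t < (SUP a. g a)" using sup by simp
    with True have "{x. t < f x} \<noteq> {}" "{x. t < g x} \<noteq> {}"
      unfolding less_SUP_iff by auto
    then show ?thesis by (rule brunn_minkowski_real) (use F lam le in auto)
  next
    case False
    then have "\<not> t < (SUP a. g a)" using sup by simp
    with False have "{x. t < f x} = {}" "{x. t < g x} = {}"
      unfolding less_SUP_iff by auto
    then show ?thesis by simp
  qed
  let ?e = "\<lambda>h t. indicator {0..} t * emeasure lborel {x. ennreal t < h x}"
  have "ennreal (1 - lam) * (\<integral>\<^sup>+ a. f a \<partial>lborel) + ennreal lam * (\<integral>\<^sup>+ a. g a \<partial>lborel)
    = (\<integral>\<^sup>+ t. ennreal (1 - lam) * ?e f t + ennreal lam * ?e g t \<partial>lborel)"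
    unfolding layer_cake(1)[OF assms(1)] layer_cake(1)[OF assms(2)]
    by (simp add: nn_integral_add nn_integral_cmult layer_cake(2))
  also have "\<dots> \<le> (\<integral>\<^sup>+ t. ?e F t \<partial>lborel)"
    using le' by (intro nn_integral_mono) (auto simp: indicator_def)
  also have "\<dots> = (\<integral>\<^sup>+ a. F a \<partial>lborel)" by (rule layer_cake(1)[OF mF, symmetric])
  finally show ?thesis .
qed

section \<open>Integration over parallel lines\<close>

text \<open>Every line in direction \<open>\<nu>\<close> meets the slab in a segment of length one, so integrating the
  line integrals over the slab counts each point once.\<close>

lemma nn_integral_slab_lines:
  fixes \<phi> :: "'a::euclidean_space \<Rightarrow> ennreal"
  assumes [measurable]: "\<phi> \<in> borel_measurable borel" and \<nu>: "norm \<nu> = 1"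
  shows "(\<integral>\<^sup>+ x. indicator {x. x \<bullet> \<nu> \<in> {0..<1}} x * (\<integral>\<^sup>+ a. \<phi> (x + a *\<^sub>R \<nu>) \<partial>lborel) \<partial>lborel)
    = (\<integral>\<^sup>+ x. \<phi> x \<partial>lborel)"
proof -
  let ?w = "indicator {x. x \<bullet> \<nu> \<in> {0..<1}} :: 'a \<Rightarrow> ennreal"
  have [measurable]: "?w \<in> borel_measurable borel"
    by (intro borel_measurable_indicator) measurable
  have nn: "\<nu> \<bullet> \<nu> = 1" using \<nu> by (simp add: dot_square_norm)
  have "(\<integral>\<^sup>+ x. ?w x * (\<integral>\<^sup>+ a. \<phi> (x + a *\<^sub>R \<nu>) \<partial>lborel) \<partial>lborel)
    = (\<integral>\<^sup>+ x. (\<integral>\<^sup>+ a. ?w x * \<phi> (x + a *\<^sub>R \<nu>) \<partial>lborel) \<partial>lborel)"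
    by (intro nn_integral_cong nn_integral_cmult[symmetric]) measurable
  also have "\<dots> = (\<integral>\<^sup>+ a. (\<integral>\<^sup>+ x. ?w x * \<phi> (x + a *\<^sub>R \<nu>) \<partial>lborel) \<partial>lborel)"
    by (rule lborel_pair.Fubini'[symmetric]) measurable
  \<comment> \<open>For fixed \<open>a\<close>, translation by \<open>a *\<^sub>R \<nu>\<close>
    moves the shift from \<phi> to the slab.\<close>
  also have "\<dots> = (\<integral>\<^sup>+ a. (\<integral>\<^sup>+ x. ?w (x - a *\<^sub>R \<nu>) * \<phi> x \<partial>lborel) \<partial>lborel)"
  proof (rule nn_integral_cong)
    fix a :: real
    have "(\<integral>\<^sup>+ x. ?w (x - a *\<^sub>R \<nu>) * \<phi> x \<partial>lborel)
      = (\<integral>\<^sup>+ x. ?w (x - a *\<^sub>R \<nu>) * \<phi> x \<partial>distr lborel borel ((+) (a *\<^sub>R \<nu>)))"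
      by (simp add: lborel_distr_plus)
    also have "\<dots> = (\<integral>\<^sup>+ x. ?w x * \<phi> (x + a *\<^sub>R \<nu>) \<partial>lborel)"
      by (subst nn_integral_distr) (simp_all add: add.commute)
    finally show "(\<integral>\<^sup>+ x. ?w x * \<phi> (x + a *\<^sub>R \<nu>) \<partial>lborel)
      = (\<integral>\<^sup>+ x. ?w (x - a *\<^sub>R \<nu>) * \<phi> x \<partial>lborel)" ..
  qed
  also have "\<dots> = (\<integral>\<^sup>+ x. (\<integral>\<^sup>+ a. ?w (x - a *\<^sub>R \<nu>) * \<phi> x \<partial>lborel) \<partial>lborel)"
    by (rule lborel_pair.Fubini') measurable
  also have "\<dots> = (\<integral>\<^sup>+ x. \<phi> x \<partial>lborel)"
  proof (rule nn_integral_cong)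
    fix x
    \<comment> \<open>The parameters that put the shifted point into the slab form a half-open
      interval of length 1, since \<open>\<nu> \<bullet> \<nu> = 1\<close>.\<close>
    have "(\<integral>\<^sup>+ a. ?w (x - a *\<^sub>R \<nu>) * \<phi> x \<partial>lborel)
      = (\<integral>\<^sup>+ a. \<phi> x * indicator {x \<bullet> \<nu> - 1 <.. x \<bullet> \<nu>} a \<partial>lborel)"
      by (intro nn_integral_cong) (auto simp: indicator_def inner_diff_left nn)
    also have "\<dots> = \<phi> x" by (simp add: nn_integral_cmult)
    finally show "(\<integral>\<^sup>+ a. ?w (x - a *\<^sub>R \<nu>) * \<phi> x \<partial>lborel) = \<phi> x" .
  qed
  finally show ?thesis .
qed

text \<open>The slab formula needs Borel functions, while convex superlevel sets only give Lebesgue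
  measurability. A Borel representative differs from \<open>F\<close> inside a null set, and by the
  slab formula almost every line based in the slab meets that set in a set of length 0.\<close>

lemma lebesgue_borel_representative_on_lines:
  fixes F :: "'a::euclidean_space \<Rightarrow> ennreal"
  assumes F: "F \<in> borel_measurable lebesgue" and \<nu>: "norm \<nu> = 1"
  obtains F' where "F' \<in> borel_measurable borel"
    "(\<integral>\<^sup>+ x. F x \<partial>lebesgue) = (\<integral>\<^sup>+ x. F' x \<partial>lborel)"
    "AE x in lborel. x \<bullet> \<nu> \<in> {0..<1} \<longrightarrow>
      (\<integral>\<^sup>+ a. F (x + a *\<^sub>R \<nu>) \<partial>lborel) = (\<integral>\<^sup>+ a. F' (x + a *\<^sub>R \<nu>) \<partial>lborel)"
proof -
  obtain F' where F': "F' \<in> borel_measurable lborel" and ae: "AE x in lborel. F x = F' x"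
    using completion_ex_borel_measurable[OF F] by blast
  \<comment> \<open>The set of disagreement need not be Borel, so it is enlarged to a Borel null
    set.\<close>
  obtain N where N: "{x. F x \<noteq> F' x} \<subseteq> N" "N \<in> null_sets lborel"
    using ae unfolding eventually_ae_filter by auto
  have [measurable]: "N \<in> sets borel" using N by auto
  let ?w = "indicator {x. x \<bullet> \<nu> \<in> {0..<1}} :: 'a \<Rightarrow> ennreal"
  have [measurable]: "?w \<in> borel_measurable borel"
    by (intro borel_measurable_indicator) measurable
  have "(\<integral>\<^sup>+ x. ?w x * (\<integral>\<^sup>+ a. indicator N (x + a *\<^sub>R \<nu>) \<partial>lborel) \<partial>lborel) = 0"
    using N \<nu> by (subst nn_integral_slab_lines) (auto simp: null_sets_def)
  then have "AE x in lborel. ?w x * (\<integral>\<^sup>+ a. indicator N (x + a *\<^sub>R \<nu>) \<partial>lborel) = 0"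
    by (subst (asm) nn_integral_0_iff_AE) measurable
  then have "AE x in lborel. x \<bullet> \<nu> \<in> {0..<1} \<longrightarrow>
      (\<integral>\<^sup>+ a. F (x + a *\<^sub>R \<nu>) \<partial>lborel) = (\<integral>\<^sup>+ a. F' (x + a *\<^sub>R \<nu>) \<partial>lborel)"
  proof (rule eventually_mono, intro impI)
    fix x assume "?w x * (\<integral>\<^sup>+ a. indicator N (x + a *\<^sub>R \<nu>) \<partial>lborel) = 0" "x \<bullet> \<nu> \<in> {0..<1}"
    then have "(\<integral>\<^sup>+ a. indicator N (x + a *\<^sub>R \<nu>) \<partial>lborel) = 0" by simp
    then have "AE a in lborel. (indicator N (x + a *\<^sub>R \<nu>) :: ennreal) = 0"
      by (subst (asm) nn_integral_0_iff_AE) measurable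
    then show "(\<integral>\<^sup>+ a. F (x + a *\<^sub>R \<nu>) \<partial>lborel) = (\<integral>\<^sup>+ a. F' (x + a *\<^sub>R \<nu>) \<partial>lborel)"
      using N(1) by (intro nn_integral_cong_AE) (auto elim!: eventually_mono simp: indicator_def split: if_splits)
  qed
  moreover have "(\<integral>\<^sup>+ x. F x \<partial>lebesgue) = (\<integral>\<^sup>+ x. F' x \<partial>lborel)"
    using ae by (simp add: nn_integral_completion nn_integral_cong_AE)
  ultimately show ?thesis using F' that by simp
qed

section \<open>Lines orthogonal to the hyperplane and the final integration\<close>

lemma hyperplane_eq_orthogonal_unit_normal:
  fixes H :: "'a::euclidean_space set"
  assumes H: "H \<in> linear_hyperplanes" and \<nu>: "unit_normal H \<nu>"
  shows "H = {x. \<nu> \<bullet> x = 0}"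
proof (rule subspace_dim_equal)
  have nz: "\<nu> \<noteq> 0" using \<nu> by (auto simp: unit_normal_def)
  show "subspace H" using H by (simp add: linear_hyperplanes_def)
  show "dim {x. \<nu> \<bullet> x = 0} \<le> dim H"
    using H nz by (simp add: linear_hyperplanes_def dim_hyperplane)
qed (use \<nu> in \<open>auto simp: unit_normal_def subspace_hyperplane\<close>)

text \<open>The line through \<open>x\<close> meets \<open>H\<close> in the orthogonal projection of
  \<open>x\<close>, and changing the base point only shifts the parameter. Thus equal projections
  give equal suprema on every line, whichever base point is used.\<close>

lemma SUP_line_eq_proj_fun:
  fixes H :: "'a::euclidean_space set"
  assumes H: "H \<in> linear_hyperplanes" and \<nu>: "unit_normal H \<nu>"
  shows "(SUP a::real. F (x + a *\<^sub>R \<nu>)) = proj_fun H F (x - (\<nu> \<bullet> x) *\<^sub>R \<nu>)"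
proof -
  define h where "h = x - (\<nu> \<bullet> x) *\<^sub>R \<nu>"
  have "\<nu> \<bullet> \<nu> = 1" using \<nu> by (simp add: unit_normal_def dot_square_norm)
  then have h: "h \<in> H"
    unfolding hyperplane_eq_orthogonal_unit_normal[OF H \<nu>] by (simp add: h_def inner_diff_right)
  have "range (\<lambda>a::real. F (x + a *\<^sub>R \<nu>)) = (\<lambda>a. F (h + a *\<^sub>R \<nu>)) ` range ((+) (\<nu> \<bullet> x))"
    unfolding image_image by (simp add: h_def algebra_simps)
  also have "\<dots> = range (\<lambda>a. F (h + a *\<^sub>R \<nu>))" by simp
  finally show ?thesis unfolding h_def[symmetric] proj_fun_eq[OF H \<nu> h] by simp
qed

theorem corollary1p4:
  fixes f g :: "real ^ 'n \<Rightarrow> real" and lam :: real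
  assumes "log_concave f" and "log_concave g"
    and "0 < lam" and "lam < 1"
    and "\<exists>H\<in>linear_hyperplanes.
           proj_fun H (\<lambda>x. ennreal (f x)) = proj_fun H (\<lambda>x. ennreal (g x))"
  shows "(\<integral>\<^sup>+ x. asplund_sum lam f g x \<partial>lebesgue)
           \<ge> ennreal (1 - lam) * (\<integral>\<^sup>+ x. ennreal (f x) \<partial>lebesgue)
             + ennreal lam * (\<integral>\<^sup>+ x. ennreal (g x) \<partial>lebesgue)"
proof -
  let ?F = "asplund_sum lam f g"
  obtain H where H: "H \<in> linear_hyperplanes"
    and proj: "proj_fun H (\<lambda>x. ennreal (f x)) = proj_fun H (\<lambda>x. ennreal (g x))"
    using assms(5) by blast
  obtain \<nu> where \<nu>: "unit_normal H \<nu>" using unit_normal_exists[OF H] by blast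
  then have n1: "norm \<nu> = 1" by (simp add: unit_normal_def)
  note convex = convex_superlevel_log_concave[OF assms(1)] convex_superlevel_log_concave[OF assms(2)]
    convex_superlevel_asplund_sum[OF assms(1-4)]
  \<comment> \<open>This holds for every \<open>x\<close>, because the original functions are Borel
    on each line; the representatives chosen below agree with them on almost every line
    only.\<close>
  have line: "ennreal (1 - lam) * (\<integral>\<^sup>+ a. ennreal (f (x + a *\<^sub>R \<nu>)) \<partial>lborel)
      + ennreal lam * (\<integral>\<^sup>+ a. ennreal (g (x + a *\<^sub>R \<nu>)) \<partial>lborel)
      \<le> (\<integral>\<^sup>+ a. ?F (x + a *\<^sub>R \<nu>) \<partial>lborel)" for x
  proof (rule nn_integral_line_ge[OF _ _ _ assms(3,4)])
    show "(SUP a. ennreal (f (x + a *\<^sub>R \<nu>))) = (SUP a. ennreal (g (x + a *\<^sub>R \<nu>)))"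
      using SUP_line_eq_proj_fun[OF H \<nu>, of "\<lambda>x. ennreal (f x)" x]
        SUP_line_eq_proj_fun[OF H \<nu>, of "\<lambda>x. ennreal (g x)" x] proj by simp
    fix a b t assume ab: "t < ennreal (f (x + a *\<^sub>R \<nu>))" "t < ennreal (g (x + b *\<^sub>R \<nu>))"
    then obtain r where r: "t = ennreal r" "0 \<le> r" by (cases t) auto
    with ab have "r < f (x + a *\<^sub>R \<nu>)" "r < g (x + b *\<^sub>R \<nu>)" by (auto simp: ennreal_less_iff)
    from less_geometric_mean[OF r(2) this assms(3,4)] r
    have "t < ennreal (f (x + a *\<^sub>R \<nu>) powr (1 - lam) * g (x + b *\<^sub>R \<nu>) powr lam)"
      by (simp add: ennreal_less_iff)
    moreover have "(1 - lam) *\<^sub>R (x + a *\<^sub>R \<nu>) + lam *\<^sub>R (x + b *\<^sub>R \<nu>)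
      = x + ((1 - lam) * a + lam * b) *\<^sub>R \<nu>"
      by (simp add: algebra_simps)
    ultimately show "t < ?F (x + ((1 - lam) * a + lam * b) *\<^sub>R \<nu>)"
      unfolding less_asplund_sum_iff by blast
  qed (intro borel_measurable_quasiconcave_real convex_superlevel_line[where F = ?F]
      convex_superlevel_line[where F = "\<lambda>x. ennreal (f x)"]
      convex_superlevel_line[where F = "\<lambda>x. ennreal (g x)"] convex)+
  note repr = lebesgue_borel_representative_on_lines[OF borel_measurable_lebesgue_quasiconcave n1]
  obtain f' where f': "f' \<in> borel_measurable borel"
    "(\<integral>\<^sup>+ x. ennreal (f x) \<partial>lebesgue) = (\<integral>\<^sup>+ x. f' x \<partial>lborel)"
    "AE x in lborel. x \<bullet> \<nu> \<in> {0..<1} \<longrightarrow>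
      (\<integral>\<^sup>+ a. ennreal (f (x + a *\<^sub>R \<nu>)) \<partial>lborel) = (\<integral>\<^sup>+ a. f' (x + a *\<^sub>R \<nu>) \<partial>lborel)"
    by (rule repr[OF convex(1)])
  obtain g' where g': "g' \<in> borel_measurable borel"
    "(\<integral>\<^sup>+ x. ennreal (g x) \<partial>lebesgue) = (\<integral>\<^sup>+ x. g' x \<partial>lborel)"
    "AE x in lborel. x \<bullet> \<nu> \<in> {0..<1} \<longrightarrow>
      (\<integral>\<^sup>+ a. ennreal (g (x + a *\<^sub>R \<nu>)) \<partial>lborel) = (\<integral>\<^sup>+ a. g' (x + a *\<^sub>R \<nu>) \<partial>lborel)"
    by (rule repr[OF convex(2)])
  obtain F' where F': "F' \<in> borel_measurable borel"
    "(\<integral>\<^sup>+ x. ?F x \<partial>lebesgue) = (\<integral>\<^sup>+ x. F' x \<partial>lborel)"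
    "AE x in lborel. x \<bullet> \<nu> \<in> {0..<1} \<longrightarrow>
      (\<integral>\<^sup>+ a. ?F (x + a *\<^sub>R \<nu>) \<partial>lborel) = (\<integral>\<^sup>+ a. F' (x + a *\<^sub>R \<nu>) \<partial>lborel)"
    by (rule repr[OF convex(3)])
  note [measurable] = f'(1) g'(1) F'(1)
  let ?w = "indicator {x. x \<bullet> \<nu> \<in> {0..<1}} :: real ^ 'n \<Rightarrow> ennreal"
  let ?L = "\<lambda>\<phi> x. ?w x * (\<integral>\<^sup>+ a. \<phi> (x + a *\<^sub>R \<nu>) \<partial>lborel)"
  have [measurable]: "?w \<in> borel_measurable borel"
    by (intro borel_measurable_indicator) measurable
  have [measurable]: "?L f' \<in> borel_measurable borel" "?L g' \<in> borel_measurable borel"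
    by measurable
  \<comment> \<open>Inside the slab the line integrals of the representatives can be replaced by the
    original ones, and \<open>line\<close> applies; outside it both sides are 0.\<close>
  have "AE x in lborel. ennreal (1 - lam) * ?L f' x + ennreal lam * ?L g' x \<le> ?L F' x"
    using f'(3) g'(3) F'(3)
  proof eventually_elim
    case (elim x)
    then show ?case using line[of x] by (cases "x \<bullet> \<nu> \<in> {0..<1}") auto
  qed
  then have "(\<integral>\<^sup>+ x. ennreal (1 - lam) * ?L f' x + ennreal lam * ?L g' x \<partial>lborel)
    \<le> (\<integral>\<^sup>+ x. ?L F' x \<partial>lborel)"
    by (rule nn_integral_mono_AE)
  then have "ennreal (1 - lam) * (\<integral>\<^sup>+ x. ?L f' x \<partial>lborel) + ennreal lam * (\<integral>\<^sup>+ x. ?L g' x \<partial>lborel)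
    \<le> (\<integral>\<^sup>+ x. ?L F' x \<partial>lborel)"
    by (simp add: nn_integral_add nn_integral_cmult)
  then show ?thesis
    unfolding nn_integral_slab_lines[OF f'(1) n1] nn_integral_slab_lines[OF g'(1) n1]
      nn_integral_slab_lines[OF F'(1) n1] f'(2) g'(2) F'(2) .
qed

end
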